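(* Let $\Lambda=\{1,\dots,N\}$, let $X_i\subseteq\mathbb{R}^{n_i}$, $K_i:X\rightrightarrows\mathbb{R}^{n_i}$ and $P_i:\mathbb{R}^n\rightrightarrows\mathbb{R}^{n_i}$ ($i\in\Lambda$), where $n=\sum_{i\in\Lambda}n_i$ and $X=\prod_{i\in\Lambda}X_i$. Let $K:X\rightrightarrows\mathbb{R}^n$ be $K(x)=\prod_{i\in\Lambda}K_i(x)$ and let $T:\mathbb{R}^n\rightrightarrows\mathbb{R}^n$ be the map built from the $P_i$ as in the context. Suppose that for each $i\in\Lambda$: (a) $X_i\subset\mathbb{R}^{n_i}$ is non-empty, convex and closed; (b) $K_i(x)\neq\emptyset$ for every $x\in X$; (c) $P_i(y)$ is an open subset of $\mathbb{R}^{n_i}$ for every $y\in\prod_{j\in\Lambda}co(\overline{K_j(X)})$. Then any projected solution of $QVI(T,K)$ is also a projected solution of the generalized Nash game $\Gamma=(X_i,K_i,P_i)_{i\in\Lambda}$.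
   Context: $n_i\ge 1$ are integers. All spaces carry the Euclidean inner product $\langle\cdot,\cdot\rangle$ and norm. $A\rightrightarrows B$ denotes a multi-valued map (each point of $A$ is sent to a possibly empty subset of $B$). $co$ denotes convex hull, an overline denotes closure, and $K_i(X)=\bigcup_{x\in X}K_i(x)$. A vector $x\in\mathbb{R}^n$ is written $x=(x_i)_{i\in\Lambda}=(x_{-i},x_i)$ with $x_i\in\mathbb{R}^{n_i}$. Definition of $T$: put $\tilde P_i(x)=co(P_i(x))$ and $$\mathcal N_{\tilde P_i}(x)=\{x_i^*\in\mathbb{R}^{n_i}\mid \langle x_i^*,z_i-x_i\rangle\le 0\ \text{for all } z_i\in\tilde P_i(x)\}$$ (so $\mathcal N_{\tilde P_i}(x)=\mathbb{R}^{n_i}$ if $\tilde P_i(x)=\emptyset$). Let $S_i[0,1]=\{v\in\mathbb{R}^{n_i}\mid\|v\|=1\}$, $T_i(x)=co(\mathcal N_{\tilde P_i}(x)\cap S_i[0,1])$ and $T(x)=\prod_{i\in\Lambda}T_i(x)$. Projected solution of $QVI(T,K)$: a vector $\tilde x\in X$ for which there exists $\tilde y\in\mathbb{R}^n$ such that (i) $\|\tilde y-\tilde x\|=\inf_{w\in X}\|\tilde y-w\|$ and (ii) $\tilde y\in K(\tilde x)$ and there is $\tilde y^*\in T(\tilde y)$ with $\langle\tilde y^*,z-\tilde y\rangle\ge0$ for all $z\in K(\tilde x)$. Projected solution of $\Gamma=(X_i,K_i,P_i)_{i\in\Lambda}$: a vector $\tilde x\in X$ for which there exists $\tilde y=(\tilde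 y_i)_{i\in\Lambda}\in\mathbb{R}^n$ such that (i) $\|\tilde y-\tilde x\|=\inf_{w\in X}\|\tilde y-w\|$ and (ii) for every $i\in\Lambda$, $\tilde y_i\in K_i(\tilde x)$ and $P_i(\tilde y)\cap K_i(\tilde x)=\emptyset$. *)

theory Defs
  imports "HOL-Analysis.Analysis"
begin

text \<open>
  \<open>\<real>\<^sup>n\<close> is the type \<open>real ^ 'n\<close>. Since the dimensions \<open>n\<^sub>i\<close> vary with the player,
  a map \<open>blk\<close> assigns every coordinate to the player who owns it, and \<open>\<real>\<^sup>n\<^sup>i\<close> is the
  coordinate subspace of the vectors supported on the coordinates of player \<open>i\<close>.
  The inner product, norm, convex hull and closure of \<open>real ^ 'n\<close> restrict to those
  of this (closed) subspace; openness in \<open>\<real>\<^sup>n\<^sup>i\<close> has to be taken relative to it.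
\<close>

definition block_space :: "('n::finite \<Rightarrow> nat) \<Rightarrow> nat \<Rightarrow> (real ^ 'n) set" where
  "block_space blk i = {v. \<forall>k. blk k \<noteq> i \<longrightarrow> v $ k = 0}"

definition block_comp :: "('n::finite \<Rightarrow> nat) \<Rightarrow> nat \<Rightarrow> real ^ 'n \<Rightarrow> real ^ 'n" where
  "block_comp blk i x = (\<chi> k. if blk k = i then x $ k else 0)"

definition block_prod ::
  "('n::finite \<Rightarrow> nat) \<Rightarrow> nat \<Rightarrow> (nat \<Rightarrow> (real ^ 'n) set) \<Rightarrow> (real ^ 'n) set" where
  "block_prod blk N A = {x. \<forall>i\<in>{1..N}. block_comp blk i x \<in> A i}"

definition normal_cone ::
  "('n::finite \<Rightarrow> nat) \<Rightarrow> (nat \<Rightarrow> real ^ 'n \<Rightarrow> (real ^ 'n) set) \<Rightarrow> nat \<Rightarrow> real ^ 'n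
    \<Rightarrow> (real ^ 'n) set" where
  "normal_cone blk P i x =
    {v \<in> block_space blk i. \<forall>z \<in> convex hull (P i x). v \<bullet> (z - block_comp blk i x) \<le> 0}"

definition T_comp ::
  "('n::finite \<Rightarrow> nat) \<Rightarrow> (nat \<Rightarrow> real ^ 'n \<Rightarrow> (real ^ 'n) set) \<Rightarrow> nat \<Rightarrow> real ^ 'n
    \<Rightarrow> (real ^ 'n) set" where
  "T_comp blk P i x =
    convex hull (normal_cone blk P i x \<inter> {v \<in> block_space blk i. norm v = 1})"

definition T_map ::
  "('n::finite \<Rightarrow> nat) \<Rightarrow> nat \<Rightarrow> (nat \<Rightarrow> real ^ 'n \<Rightarrow> (real ^ 'n) set) \<Rightarrow> real ^ 'n
    \<Rightarrow> (real ^ 'n) set" where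
  "T_map blk N P x = block_prod blk N (\<lambda>i. T_comp blk P i x)"

definition projected_solution_QVI ::
  "(real ^ 'n::finite) set \<Rightarrow> (real ^ 'n \<Rightarrow> (real ^ 'n) set) \<Rightarrow> (real ^ 'n \<Rightarrow> (real ^ 'n) set)
    \<Rightarrow> real ^ 'n \<Rightarrow> bool" where
  "projected_solution_QVI X T K x \<longleftrightarrow> x \<in> X \<and>
    (\<exists>y. norm (y - x) = (INF w\<in>X. norm (y - w)) \<and>
         y \<in> K x \<and> (\<exists>y'\<in>T y. \<forall>z\<in>K x. y' \<bullet> (z - y) \<ge> 0))"

definition projected_solution_game ::
  "('n::finite \<Rightarrow> nat) \<Rightarrow> nat \<Rightarrow> (nat \<Rightarrow> (real ^ 'n) set)
    \<Rightarrow> (nat \<Rightarrow> real ^ 'n \<Rightarrow> (real ^ 'n) set) \<Rightarrow> (nat \<Rightarrow> real ^ 'n \<Rightarrow> (real ^ 'n) set)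
    \<Rightarrow> real ^ 'n \<Rightarrow> bool" where
  "projected_solution_game blk N X K P x \<longleftrightarrow> x \<in> block_prod blk N X \<and>
    (\<exists>y. norm (y - x) = (INF w\<in>block_prod blk N X. norm (y - w)) \<and>
         (\<forall>i\<in>{1..N}. block_comp blk i y \<in> K i x \<and> P i y \<inter> K i x = {}))"

end

theory Submission
  imports Defs
begin

text \<open>
  The same pair \<open>(x, y)\<close> solves both problems; only the emptiness of
  \<open>P i y \<inter> K i x\<close> has to be shown. If \<open>z\<close> were a common point, replacing the \<open>i\<close>-th block of
  \<open>y\<close> by \<open>z\<close> would give an admissible test point of the variational inequality, and only the
  \<open>i\<close>-th component \<open>w\<close> of the dual vector would see the change (\<open>inner_block_space\<close>), so that
  \<open>w \<bullet> (z - y\<^sub>i) \<ge> 0\<close>. On the other hand a non-constant affine function that is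
  non-positive on an open set is negative there
  (\<open>inner_neg_of_nonpos_on_openin_subspace\<close>). Hence every unit normal \<open>v\<close>
  satisfies \<open>v \<bullet> (z - y\<^sub>i) < 0\<close>, and this strict inequality survives convex
  combinations (\<open>T_comp_inner_neg\<close>), in particular it holds for \<open>w\<close>: a contradiction.
  Restricting the normal cone to the unit sphere before taking the convex hull is what
  excludes the zero normal, for which the strict inequality fails.
\<close>

text \<open>
  A nonzero vector \<open>v\<close> of the subspace defines a functional without a maximum on \<open>U\<close>:
  moving from \<open>z\<close> a little in the direction \<open>v\<close>, which stays in the subspace, increases its
  value strictly.
\<close>

lemma inner_neg_of_nonpos_on_openin_subspace:
  fixes v :: "'a::real_inner"
  assumes V: "subspace V"
    and U: "openin (top_of_set V) U"
    and v: "v \<in> V" "v \<noteq> 0"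
    and le: "\<And>u. u \<in> U \<Longrightarrow> v \<bullet> (u - p) \<le> 0"
    and z: "z \<in> U"
  shows "v \<bullet> (z - p) < 0"
proof -
  obtain e where e: "e > 0" "ball z e \<inter> V \<subseteq> U"
    using U z by (meson openin_contains_ball)
  have zV: "z \<in> V"
    using U z openin_imp_subset by blast
  define t where "t = e / (2 * norm v)"
  have t: "t > 0"
    using e v by (simp add: t_def)
  have "dist z (z + t *\<^sub>R v) < e"
    using e v by (simp add: t_def dist_norm)
  moreover have "z + t *\<^sub>R v \<in> V"
    using V zV v by (simp add: subspace_add subspace_scale)
  ultimately have "z + t *\<^sub>R v \<in> U"
    using e by (auto simp: mem_ball)
  then have "v \<bullet> (z + t *\<^sub>R v - p) \<le> 0"
    by (rule le)
  then have "v \<bullet> (z - p) + t * (v \<bullet> v) \<le> 0"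
    by (simp add: inner_diff_right inner_add_right)
  moreover have "t * (v \<bullet> v) > 0"
    using t v by simp
  ultimately show ?thesis
    by linarith
qed

lemma subspace_block_space: "subspace (block_space blk i)"
  by (auto simp: block_space_def subspace_def)

lemma block_comp_in_block_space: "block_comp blk i x \<in> block_space blk i"
  by (simp add: block_comp_def block_space_def)

lemma inner_block_space:
  assumes "d \<in> block_space blk i"
  shows "y \<bullet> d = block_comp blk i y \<bullet> d"
  using assms by (auto simp: inner_vec_def block_space_def block_comp_def intro!: sum.cong)

lemma block_comp_replace:
  assumes "z \<in> block_space blk i"
  shows "block_comp blk j (y + (z - block_comp blk i y)) =
    (if j = i then z else block_comp blk j y)"
  using assms by (auto simp: block_comp_def block_space_def vec_eq_iff)

text \<open>
  An open half-space through the origin is convex, so it contains the convex hull of the unit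
  normals as soon as it contains each of them.
\<close>

lemma T_comp_inner_neg:
  assumes P: "openin (top_of_set (block_space blk i)) (P i y)"
    and z: "z \<in> P i y"
    and w: "w \<in> T_comp blk P i y"
  shows "w \<bullet> (z - block_comp blk i y) < 0"
proof -
  define d where "d = z - block_comp blk i y"
  have "v \<bullet> d < 0"
    if v: "v \<in> normal_cone blk P i y" "v \<in> block_space blk i" "norm v = 1" for v
    unfolding d_def
  proof (rule inner_neg_of_nonpos_on_openin_subspace[OF subspace_block_space P])
    show "v \<bullet> (u - block_comp blk i y) \<le> 0" if "u \<in> P i y" for u
      using v that by (auto simp: normal_cone_def intro: hull_inc)
  qed (use v z in auto)
  then have "normal_cone blk P i y \<inter> {v \<in> block_space blk i. norm v = 1} \<subseteq> {v. d \<bullet> v < 0}"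
    by (auto simp: inner_commute)
  then have "T_comp blk P i y \<subseteq> {v. d \<bullet> v < 0}"
    unfolding T_comp_def by (rule hull_minimal) (rule convex_halfspace_lt)
  then show ?thesis
    using w by (auto simp: d_def inner_commute)
qed

theorem theorem3p1:
  fixes N :: nat
    and dims :: "nat \<Rightarrow> nat"
    and blk :: "'n::finite \<Rightarrow> nat"
    and X :: "nat \<Rightarrow> (real ^ 'n) set"
    and K P :: "nat \<Rightarrow> real ^ 'n \<Rightarrow> (real ^ 'n) set"
    and x :: "real ^ 'n"
  assumes blk: "\<forall>k. blk k \<in> {1..N}"
    and dims: "\<forall>i\<in>{1..N}. dims i \<ge> 1 \<and> card {k. blk k = i} = dims i"
    and X_sub: "\<forall>i\<in>{1..N}. X i \<subseteq> block_space blk i"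
    and K_sub: "\<forall>i\<in>{1..N}. \<forall>u\<in>block_prod blk N X. K i u \<subseteq> block_space blk i"
    and P_sub: "\<forall>i\<in>{1..N}. \<forall>u. P i u \<subseteq> block_space blk i"
    and a: "\<forall>i\<in>{1..N}. X i \<noteq> {} \<and> convex (X i) \<and> closed (X i)"
    and b: "\<forall>i\<in>{1..N}. \<forall>u\<in>block_prod blk N X. K i u \<noteq> {}"
    and c: "\<forall>i\<in>{1..N}.
      \<forall>y\<in>block_prod blk N (\<lambda>j. convex hull (closure (\<Union>u\<in>block_prod blk N X. K j u))).
        openin (top_of_set (block_space blk i)) (P i y)"
    and sol: "projected_solution_QVI (block_prod blk N X)
      (T_map blk N P) (\<lambda>u. block_prod blk N (\<lambda>i. K i u)) x"
  shows "projected_solution_game blk N X K P x"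
proof -
  obtain y y' where xX: "x \<in> block_prod blk N X"
    and proj: "norm (y - x) = (INF w\<in>block_prod blk N X. norm (y - w))"
    and yK: "y \<in> block_prod blk N (\<lambda>i. K i x)"
    and y'T: "y' \<in> T_map blk N P y"
    and VI: "\<And>u. u \<in> block_prod blk N (\<lambda>i. K i x) \<Longrightarrow> y' \<bullet> (u - y) \<ge> 0"
    using sol by (auto simp: projected_solution_QVI_def)
  have yK: "block_comp blk i y \<in> K i x" if "i \<in> {1..N}" for i
    using yK that by (simp add: block_prod_def)
  have y'T: "block_comp blk i y' \<in> T_comp blk P i y" if "i \<in> {1..N}" for i
    using y'T that by (simp add: T_map_def block_prod_def)
  have "block_comp blk j y \<in> convex hull (closure (\<Union>u\<in>block_prod blk N X. K j u))"
    if "j \<in> {1..N}" for j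
    using yK[OF that] xX by (intro hull_inc subsetD[OF closure_subset]) blast
  then have y_dom:
    "y \<in> block_prod blk N (\<lambda>j. convex hull (closure (\<Union>u\<in>block_prod blk N X. K j u)))"
    by (simp add: block_prod_def)
  have "P i y \<inter> K i x = {}" if i: "i \<in> {1..N}" for i
  proof (rule ccontr)
    assume "P i y \<inter> K i x \<noteq> {}"
    then obtain z where z: "z \<in> P i y" "z \<in> K i x"
      by blast
    have z_block: "z \<in> block_space blk i"
      using P_sub i z by blast
    define d where "d = z - block_comp blk i y"
    \<comment> \<open>A unilateral deviation of player \<open>i\<close> from \<open>y\<^sub>i\<close> to \<open>z\<close>.\<close>
    have "y + d \<in> block_prod blk N (\<lambda>i. K i x)"
      using yK z by (auto simp: d_def block_prod_def block_comp_replace[OF z_block])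
    then have "y' \<bullet> d \<ge> 0"
      using VI by fastforce
    moreover have "d \<in> block_space blk i"
      unfolding d_def
      by (intro subspace_diff subspace_block_space z_block block_comp_in_block_space)
    ultimately have "block_comp blk i y' \<bullet> d \<ge> 0"
      using inner_block_space by metis
    moreover have "block_comp blk i y' \<bullet> d < 0"
      unfolding d_def using c i y_dom z y'T by (intro T_comp_inner_neg) auto
    ultimately show False
      by linarith
  qed
  then show ?thesis
    unfolding projected_solution_game_def using xX proj yK by blast
qed

end
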